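(* Let $q>0$, $q\neq1$, and let $l,\lambda\in\mathbb{R}$ with $l\neq0$. The operators $a+a^\dagger$ and $i(a-a^\dagger)$, defined on the Fock space $\mathcal{F}$, are bounded and, consequently, self-adjoint if $q>1$. If $q<1$, they are not self-adjoint.
   Context: $\mathcal{F}$ is the Fock space with orthonormal basis $\{|n\rangle: n=0,1,2,\dots\}$. With $[n]_q=\frac{1-q^n}{1-q}$ and $x_n=\left(l^2q^{\lambda-n}[n]_q\right)^{1/2}$, the mutually adjoint operators $a$ and $a^\dagger$ act on the basis vectors by $a|n\rangle=x_n|n-1\rangle$ for $n\ge 1$, $a|0\rangle=0$, and $a^\dagger|n\rangle=x_{n+1}|n+1\rangle$ for $n\ge0$. They are the annihilation and creation operators of the $(q;l,\lambda)$-deformed Heisenberg algebra $[N,a]=-a$, $[N,a^\dagger]=a^\dagger$, $aa^\dagger-a^\dagger a=l^2q^{-N+\lambda-1}$, with $N|n\rangle=n|n\rangle$. In the basis $|n\rangle$ the operators $a+a^\dagger$ and $i(a-a^\dagger)$ are represented by Jacobi (tridiagonal) matrices with zero diagonal and off-diagonal entries $x_n$, respectively $\pm i x_n$. *)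

theory Defs
  imports "HOL-Analysis.Analysis"
begin

section \<open>The Fock space\<close>

text \<open>
  HOL-Analysis has no complex Hilbert spaces, so the Fock space is realised as the space of
  square-summable complex sequences: \<open>amp f n\<close> is the coefficient of \<open>f\<close> at the basis vector
  \<open>|n\<rangle>\<close>.  The sesquilinear inner product is \<open>cinner\<close>; the real inner product required by the
  type class is its real part, which induces the same norm.
\<close>

typedef fock = "{f :: nat \<Rightarrow> complex. summable (\<lambda>n. (cmod (f n))\<^sup>2)}"
  morphisms amp Fock
  by (rule exI[of _ "\<lambda>_. 0"]) simp

lemma summable_amp: "summable (\<lambda>n. (cmod (amp f n))\<^sup>2)"
  using amp[of f] by simp

lemma amp_Fock: "summable (\<lambda>n. (cmod (f n))\<^sup>2) \<Longrightarrow> amp (Fock f) = f"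
  by (simp add: Fock_inverse)

lemma fock_eqI: "(\<And>n. amp f n = amp g n) \<Longrightarrow> f = g"
  by (metis amp_inject ext)

lemma fock_eq_iff: "f = g \<longleftrightarrow> (\<forall>n. amp f n = amp g n)"
  using fock_eqI by blast

lemma cmod_add_square_le: "(cmod (a + b))\<^sup>2 \<le> 2 * ((cmod a)\<^sup>2 + (cmod b)\<^sup>2)"
proof -
  have "(cmod (a + b))\<^sup>2 \<le> (cmod a + cmod b)\<^sup>2"
    by (intro power_mono norm_triangle_ineq) auto
  also have "\<dots> \<le> 2 * ((cmod a)\<^sup>2 + (cmod b)\<^sup>2)"
    using sum_squares_bound[of "cmod a" "cmod b"] by (simp add: power2_sum)
  finally show ?thesis .
qed

lemma summable_l2_add:
  assumes "summable (\<lambda>n. (cmod (f n))\<^sup>2)" "summable (\<lambda>n. (cmod (g n))\<^sup>2)"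
  shows "summable (\<lambda>n. (cmod (f n + g n))\<^sup>2)"
  by (rule summable_comparison_test'[where N = 0, OF summable_mult[OF summable_add[OF assms], of 2]])
     (use cmod_add_square_le in \<open>simp add: distrib_left\<close>)

lemma summable_l2_mult:
  "summable (\<lambda>n. (cmod (f n))\<^sup>2) \<Longrightarrow> summable (\<lambda>n. (cmod (c * f n))\<^sup>2)"
  by (simp add: norm_mult power_mult_distrib summable_mult)

lemma summable_l2_finite:
  "finite A \<Longrightarrow> (\<And>n. n \<notin> A \<Longrightarrow> f n = 0) \<Longrightarrow> summable (\<lambda>n. (cmod (f n))\<^sup>2)"
  by (rule summable_finite[of A]) auto

definition scaleC :: "complex \<Rightarrow> fock \<Rightarrow> fock"  (infixr "*\<^sub>C" 75) where
  "c *\<^sub>C f = Fock (\<lambda>n. c * amp f n)"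

definition cinner :: "fock \<Rightarrow> fock \<Rightarrow> complex" where
  "cinner f g = (\<Sum>n. cnj (amp f n) * amp g n)"

lemma amp_scaleC: "amp (c *\<^sub>C f) n = c * amp f n"
  by (simp add: scaleC_def amp_Fock summable_l2_mult summable_amp)

lemma summable_cinner: "summable (\<lambda>n. cnj (amp f n) * amp g n)"
proof (rule summable_comparison_test'[where N = 0])
  show "summable (\<lambda>n. (cmod (amp f n))\<^sup>2 + (cmod (amp g n))\<^sup>2)"
    by (intro summable_add summable_amp)
  show "norm (cnj (amp f n) * amp g n) \<le> (cmod (amp f n))\<^sup>2 + (cmod (amp g n))\<^sup>2" for n
    using sum_squares_bound[of "cmod (amp f n)" "cmod (amp g n)"]
      mult_nonneg_nonneg[OF norm_ge_zero[of "amp f n"] norm_ge_zero[of "amp g n"]]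
    unfolding norm_mult complex_mod_cnj by linarith
qed

instantiation fock :: real_inner
begin

definition "0 = Fock (\<lambda>_. 0)"
definition "f + g = Fock (\<lambda>n. amp f n + amp g n)"
definition "- f = Fock (\<lambda>n. - amp f n)"
definition "f - g = Fock (\<lambda>n. amp f n - amp g n)"
definition "r *\<^sub>R f = Fock (\<lambda>n. r *\<^sub>R amp f n)"
definition "inner f g = Re (cinner f g)"
definition "norm (f :: fock) = sqrt (inner f f)"
definition "sgn (f :: fock) = inverse (norm f) *\<^sub>R f"
definition "dist f (g :: fock) = norm (f - g)"
definition "uniformity = (INF e\<in>{0 <..}. principal {(f, g :: fock). dist f g < e})"
definition "open U = (\<forall>f\<in>U. eventually (\<lambda>(f', g). f' = f \<longrightarrow> g \<in> U) (uniformity :: (fock \<times> fock) filter))"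

lemma amp_zero [simp]: "amp 0 n = 0"
  by (simp add: zero_fock_def amp_Fock)

lemma amp_add [simp]: "amp (f + g) n = amp f n + amp g n"
  by (simp add: plus_fock_def amp_Fock summable_l2_add summable_amp)

lemma amp_uminus [simp]: "amp (- f) n = - amp f n"
  by (simp add: uminus_fock_def amp_Fock summable_amp)

lemma amp_minus [simp]: "amp (f - g) n = amp f n - amp g n"
proof -
  have "summable (\<lambda>n. (cmod (amp f n + - amp g n))\<^sup>2)"
    by (intro summable_l2_add) (simp_all add: summable_amp)
  then show ?thesis by (simp add: minus_fock_def amp_Fock)
qed

lemma amp_scaleR [simp]: "amp (r *\<^sub>R f) n = r *\<^sub>R amp f n"
  using summable_l2_mult[OF summable_amp, of "of_real r" f]
  by (simp add: scaleR_fock_def amp_Fock scaleR_conv_of_real)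

lemma inner_fock_sums: "(\<lambda>n. Re (cnj (amp f n) * amp g n)) sums inner f g"
  unfolding inner_fock_def cinner_def
  by (intro sums_Re summable_sums summable_cinner)

lemma inner_self_sums: "(\<lambda>n. (cmod (amp f n))\<^sup>2) sums inner f f"
  using inner_fock_sums[of f f] by (simp add: cmod_power2 flip: power2_eq_square)

instance
proof
  fix f g h :: fock and r s :: real
  show "f + g + h = f + (g + h)" "f + g = g + f" "0 + f = f" "- f + f = 0" "f - g = f + - g"
    "r *\<^sub>R (f + g) = r *\<^sub>R f + r *\<^sub>R g" "(r + s) *\<^sub>R f = r *\<^sub>R f + s *\<^sub>R f"
    "r *\<^sub>R s *\<^sub>R f = (r * s) *\<^sub>R f" "1 *\<^sub>R f = f"
    by (auto intro!: fock_eqI simp: algebra_simps)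
  show "dist f g = norm (f - g)" by (simp add: dist_fock_def)
  show "sgn f = inverse (norm f) *\<^sub>R f" by (simp add: sgn_fock_def)
  show "uniformity = (INF e\<in>{0 <..}. principal {(f, g :: fock). dist f g < e})"
    by (simp add: uniformity_fock_def)
  show "open U = (\<forall>f\<in>U. eventually (\<lambda>(f', g). f' = f \<longrightarrow> g \<in> U) uniformity)" for U :: "fock set"
    by (simp add: open_fock_def)
  show "inner f g = inner g f"
    using sums_unique2[OF inner_fock_sums[of f g]] inner_fock_sums[of g f]
    by (simp add: mult.commute)
  have "(\<lambda>n. Re (cnj (amp (f + g) n) * amp h n)) sums (inner f h + inner g h)"
    using sums_add[OF inner_fock_sums[of f h] inner_fock_sums[of g h]] by (simp add: algebra_simps)
  then show "inner (f + g) h = inner f h + inner g h"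
    by (rule sums_unique2[OF inner_fock_sums])
  have "(\<lambda>n. Re (cnj (amp (r *\<^sub>R f) n) * amp g n)) sums (r * inner f g)"
    using sums_mult[OF inner_fock_sums[of f g], of r] by (simp add: algebra_simps)
  then show "inner (r *\<^sub>R f) g = r * inner f g"
    by (rule sums_unique2[OF inner_fock_sums])
  show nonneg: "0 \<le> inner f f"
    using sums_le[OF _ sums_zero inner_self_sums[of f]] by simp
  show "inner f f = 0 \<longleftrightarrow> f = 0"
  proof
    assume "inner f f = 0"
    then have "(\<Sum>n. (cmod (amp f n))\<^sup>2) = 0"
      using inner_self_sums[of f] by (simp add: sums_iff)
    then have "\<forall>n. (cmod (amp f n))\<^sup>2 = 0"
      by (subst (asm) suminf_eq_zero_iff[OF summable_amp]) auto
    then show "f = 0" by (auto intro: fock_eqI)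
  next
    assume "f = 0"
    then show "inner f f = 0" using inner_self_sums[of f] by (simp add: sums_iff)
  qed
  show "norm f = sqrt (inner f f)" by (simp add: norm_fock_def)
qed

end

lemma norm_fock_sums: "(\<lambda>n. (cmod (amp f n))\<^sup>2) sums (norm f)\<^sup>2"
  using inner_self_sums[of f] by (simp add: power2_norm_eq_inner)

lemma cmod_amp_le_norm: "cmod (amp f n) \<le> norm f"
proof -
  have "(\<Sum>k\<in>{n}. (cmod (amp f k))\<^sup>2) \<le> (norm f)\<^sup>2"
    using norm_fock_sums[of f] sum_le_suminf[OF summable_amp, of "{n}" f] by (simp add: sums_iff)
  then show ?thesis by (simp add: power2_le_iff_abs_le)
qed

instance fock :: complete_space
proof
  fix X :: "nat \<Rightarrow> fock"
  assume X: "Cauchy X"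
  have "Cauchy (\<lambda>m. amp (X m) n)" for n
  proof (rule metric_CauchyI)
    fix e :: real assume "e > 0"
    then obtain M where "\<forall>m\<ge>M. \<forall>k\<ge>M. dist (X m) (X k) < e"
      using X by (auto simp: Cauchy_def)
    then show "\<exists>M. \<forall>m\<ge>M. \<forall>k\<ge>M. dist (amp (X m) n) (amp (X k) n) < e"
      using cmod_amp_le_norm[of "X _ - X _" n] unfolding dist_norm amp_minus
      by (meson order_le_less_trans)
  qed
  then have "\<forall>n. \<exists>c. (\<lambda>m. amp (X m) n) \<longlonglongrightarrow> c"
    by (simp add: Cauchy_convergent_iff convergent_def)
  then obtain c where c: "\<And>n. (\<lambda>m. amp (X m) n) \<longlonglongrightarrow> c n" by metis
  have tail: "\<exists>M. \<forall>m\<ge>M. \<forall>N. (\<Sum>n<N. (cmod (amp (X m) n - c n))\<^sup>2) \<le> e\<^sup>2" if "e > 0" for e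
  proof -
    obtain M where M: "\<forall>m\<ge>M. \<forall>k\<ge>M. dist (X m) (X k) < e"
      using X \<open>e > 0\<close> by (auto simp: Cauchy_def)
    have "(\<Sum>n<N. (cmod (amp (X m) n - c n))\<^sup>2) \<le> e\<^sup>2" if "m \<ge> M" for m N
    proof (rule tendsto_upperbound)
      show "(\<lambda>k. \<Sum>n<N. (cmod (amp (X m) n - amp (X k) n))\<^sup>2)
          \<longlonglongrightarrow> (\<Sum>n<N. (cmod (amp (X m) n - c n))\<^sup>2)"
        by (intro tendsto_intros c)
      have "(\<Sum>n<N. (cmod (amp (X m) n - amp (X k) n))\<^sup>2) \<le> e\<^sup>2" if "k \<ge> M" for k
      proof -
        have "(\<Sum>n<N. (cmod (amp (X m - X k) n))\<^sup>2) \<le> (norm (X m - X k))\<^sup>2"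
          using norm_fock_sums[of "X m - X k"] sum_le_suminf[OF summable_amp, of "{..<N}" "X m - X k"]
          by (simp add: sums_iff)
        also have "\<dots> \<le> e\<^sup>2"
          using M \<open>m \<ge> M\<close> \<open>k \<ge> M\<close> by (intro power_mono) (auto simp: dist_norm less_imp_le)
        finally show ?thesis by simp
      qed
      then show "\<forall>\<^sub>F k in sequentially. (\<Sum>n<N. (cmod (amp (X m) n - amp (X k) n))\<^sup>2) \<le> e\<^sup>2"
        by (auto simp: eventually_sequentially)
    qed simp
    then show ?thesis by blast
  qed
  have summ: "summable (\<lambda>n. (cmod (amp (X m) n - c n))\<^sup>2)"
    if "\<forall>N. (\<Sum>n<N. (cmod (amp (X m) n - c n))\<^sup>2) \<le> e\<^sup>2" for m e
  proof (rule bounded_imp_summable)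
    show "(\<Sum>n\<le>N. (cmod (amp (X m) n - c n))\<^sup>2) \<le> e\<^sup>2" for N
      using that[rule_format, of "Suc N"] by (simp add: lessThan_Suc_atMost)
  qed simp
  obtain M where "\<forall>N. (\<Sum>n<N. (cmod (amp (X M) n - c n))\<^sup>2) \<le> 1\<^sup>2"
    using tail[of 1] by auto
  from summable_l2_add[OF summable_l2_mult[OF summ[OF this], of "-1"] summable_amp[of "X M"]]
  have "summable (\<lambda>n. (cmod (c n))\<^sup>2)" by simp
  then have L: "amp (Fock c) = c" by (rule amp_Fock)
  have "X \<longlonglongrightarrow> Fock c"
  proof (rule metric_LIMSEQ_I)
    fix r :: real assume "r > 0"
    then obtain M where M: "\<forall>m\<ge>M. \<forall>N. (\<Sum>n<N. (cmod (amp (X m) n - c n))\<^sup>2) \<le> (r/2)\<^sup>2"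
      using tail[of "r/2"] by auto
    have "dist (X m) (Fock c) < r" if "m \<ge> M" for m
    proof -
      have "(\<Sum>n. (cmod (amp (X m) n - c n))\<^sup>2) \<le> (r/2)\<^sup>2"
        using M that summ by (intro suminf_le_const) blast+
      then have "(norm (X m - Fock c))\<^sup>2 \<le> (r/2)\<^sup>2"
        using norm_fock_sums[of "X m - Fock c"] by (simp add: sums_iff L)
      then have "norm (X m - Fock c) \<le> r/2"
        using \<open>r > 0\<close> by (auto dest: power2_le_imp_le)
      then show ?thesis using \<open>r > 0\<close> by (simp add: dist_norm)
    qed
    then show "\<exists>M. \<forall>m\<ge>M. dist (X m) (Fock c) < r" by blast
  qed
  then show "convergent X" by (auto simp: convergent_def)
qed

instance fock :: banach ..

definition ket :: "nat \<Rightarrow> fock" where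
  "ket n = Fock (\<lambda>k. if k = n then 1 else 0)"

lemma amp_ket: "amp (ket n) k = (if k = n then 1 else 0)"
  unfolding ket_def by (subst amp_Fock[OF summable_l2_finite[of "{n}"]]) auto

lemma cinner_ket: "cinner (ket m) f = amp f m"
proof -
  have "(\<lambda>n. cnj (amp (ket m) n) * amp f n) sums (\<Sum>n\<in>{m}. cnj (amp (ket m) n) * amp f n)"
    by (rule sums_finite) (auto simp: amp_ket)
  then show ?thesis by (simp add: cinner_def sums_iff amp_ket)
qed

lemma ket_orthonormal: "cinner (ket m) (ket n) = (if m = n then 1 else 0)"
  by (simp add: cinner_ket amp_ket)

section \<open>Densely defined operators, as graphs\<close>

text \<open>
  A possibly unbounded operator \<open>T\<close> is represented by its graph; \<open>Domain T\<close> is its domain, and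
  the library's \<open>closure T\<close> is the graph of its closure whenever \<open>T\<close> is closable (in
  particular, whenever it is symmetric and densely defined).
\<close>

type_synonym fock_operator = "(fock \<times> fock) set"

definition adjoint :: "fock_operator \<Rightarrow> fock_operator" where
  "adjoint T = {(v, w). \<forall>(u, Tu)\<in>T. cinner v Tu = cinner w u}"

definition selfadjoint :: "fock_operator \<Rightarrow> bool" where
  "selfadjoint T \<longleftrightarrow> closure (Domain T) = UNIV \<and> adjoint T = T"

definition bounded_operator :: "fock_operator \<Rightarrow> bool" where
  "bounded_operator T \<longleftrightarrow>
    (\<exists>A. bounded_linear A \<and> (\<forall>c f. A (c *\<^sub>C f) = c *\<^sub>C A f) \<and> T = {(f, A f) |f. True})"

section \<open>The deformed oscillator operators\<close>

definition qnum :: "real \<Rightarrow> nat \<Rightarrow> real" where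
  "qnum q n = (1 - q ^ n) / (1 - q)"

definition x_coef :: "real \<Rightarrow> real \<Rightarrow> real \<Rightarrow> nat \<Rightarrow> real" where
  "x_coef q l lam n = sqrt (l\<^sup>2 * q powr (lam - real n) * qnum q n)"

text \<open>The (algebraic) linear span of the vectors \<open>ket n\<close>.\<close>

definition finite_states :: "fock set" where
  "finite_states = {f. finite {n. amp f n \<noteq> 0}}"

text \<open>The linear map on \<open>finite_states\<close> sending each \<open>ket n\<close> to \<open>b n\<close>.\<close>

definition linear_extension :: "(nat \<Rightarrow> fock) \<Rightarrow> fock \<Rightarrow> fock" where
  "linear_extension b f = (\<Sum>n | amp f n \<noteq> 0. amp f n *\<^sub>C b n)"

lemma finite_states_expansion:
  assumes "f \<in> finite_states"
  shows "f = linear_extension ket f"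
proof -
  have fin: "finite {n. amp f n \<noteq> 0}" using assms by (simp add: finite_states_def)
  have amp_sum: "amp (sum g A) n = (\<Sum>k\<in>A. amp (g k) n)" for g :: "nat \<Rightarrow> fock" and A n
    by (induction A rule: infinite_finite_induct) auto
  show ?thesis
    by (rule fock_eqI) (simp add: linear_extension_def amp_sum amp_scaleC amp_ket
        if_distrib[of "\<lambda>z. _ * z"] sum.delta'[OF fin] cong: if_cong)
qed

lemma linear_extension_ket: "linear_extension b (ket n) = b n"
proof -
  have "{k. amp (ket n) k \<noteq> 0} = {n}" by (auto simp: amp_ket)
  then show ?thesis
    by (auto intro: fock_eqI simp: linear_extension_def amp_ket amp_scaleC)
qed

definition annih :: "real \<Rightarrow> real \<Rightarrow> real \<Rightarrow> fock \<Rightarrow> fock" where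
  "annih q l lam = linear_extension
     (\<lambda>n. if n = 0 then 0 else of_real (x_coef q l lam n) *\<^sub>C ket (n - 1))"

definition creat :: "real \<Rightarrow> real \<Rightarrow> real \<Rightarrow> fock \<Rightarrow> fock" where
  "creat q l lam = linear_extension (\<lambda>n. of_real (x_coef q l lam (n + 1)) *\<^sub>C ket (n + 1))"

lemma annih_ket_0: "annih q l lam (ket 0) = 0"
  by (simp add: annih_def linear_extension_ket)

lemma annih_ket:
  "n \<ge> 1 \<Longrightarrow> annih q l lam (ket n) = of_real (x_coef q l lam n) *\<^sub>C ket (n - 1)"
  by (simp add: annih_def linear_extension_ket)

lemma creat_ket:
  "creat q l lam (ket n) = of_real (x_coef q l lam (n + 1)) *\<^sub>C ket (n + 1)"
  by (simp add: creat_def linear_extension_ket)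

text \<open>
  As usual for operators given by Jacobi matrices, \<open>a + a\<^sup>\<dagger>\<close> and \<open>i (a - a\<^sup>\<dagger>)\<close> are the closures
  of the operators defined by the matrices on the span of the basis vectors.
\<close>

definition position_op :: "real \<Rightarrow> real \<Rightarrow> real \<Rightarrow> fock_operator" where
  "position_op q l lam =
     closure {(f, annih q l lam f + creat q l lam f) |f. f \<in> finite_states}"

definition momentum_op :: "real \<Rightarrow> real \<Rightarrow> real \<Rightarrow> fock_operator" where
  "momentum_op q l lam =
     closure {(f, \<i> *\<^sub>C (annih q l lam f - creat q l lam f)) |f. f \<in> finite_states}"

end

theory Submission
  imports Defs
begin

text \<open>
  Both operators come from a Jacobi matrix with off-diagonal entries \<open>c * x n\<close>, where
  \<open>c = 1\<close> or \<open>c = \<i>\<close>.  For \<open>q > 1\<close> the \<open>x n\<close> are bounded, so the matrix defines a bounded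
  operator on the whole space, and summation by parts shows that it is symmetric.  For \<open>q < 1\<close>
  one has \<open>(x n)\<^sup>2 \<le> q * (x (n + 1))\<^sup>2\<close>, which makes both solutions of the three-term recurrence
  at spectral parameter \<open>0\<close> decay geometrically.  They lie in the domain of the adjoint, and
  their constant nonzero Wronskian shows that the adjoint is not symmetric.
\<close>

section \<open>Jacobi matrices\<close>

text \<open>At \<open>n = 0\<close> the second summand is meant to vanish; this is ensured by \<open>x 0 = 0\<close>.\<close>

definition jacobi :: "complex \<Rightarrow> (nat \<Rightarrow> real) \<Rightarrow> (nat \<Rightarrow> complex) \<Rightarrow> nat \<Rightarrow> complex" where
  "jacobi c x f n = c * of_real (x (Suc n)) * f (Suc n) + cnj c * of_real (x n) * f (n - 1)"

text \<open>Stating the action through \<open>amp\<close> avoids a summability condition: the image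
  of a finitely supported sequence is finitely supported.\<close>

definition jacobi_op :: "complex \<Rightarrow> (nat \<Rightarrow> real) \<Rightarrow> fock_operator" where
  "jacobi_op c x = {(f, g). f \<in> finite_states \<and> amp g = jacobi c x (amp f)}"

text \<open>Discrete Green identity: the interior terms telescope and only the Wronskian at the cut
  \<open>N\<close> remains. The left end contributes nothing because \<open>x 0 = 0\<close>.\<close>

lemma jacobi_green_sum:
  assumes "x 0 = 0"
  shows "(\<Sum>n<N. cnj (v n) * jacobi c x u n - cnj (jacobi c x v n) * u n) =
    of_real (x N) * (c * cnj (v (N - 1)) * u N - cnj c * cnj (v N) * u (N - 1))"
  by (induction N) (simp_all add: assms jacobi_def algebra_simps)

text \<open>Reduces symmetry to the decay of the boundary term, which is checked later for bounded
  \<open>x\<close> and for finitely supported \<open>u\<close>.\<close>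

lemma jacobi_green:
  assumes "x 0 = 0" and Tu: "amp Tu = jacobi c x (amp u)" and Tv: "amp Tv = jacobi c x (amp v)"
    and boundary: "(\<lambda>N. of_real (x N) * (c * cnj (amp v (N - 1)) * amp u N
                      - cnj c * cnj (amp v N) * amp u (N - 1))) \<longlonglongrightarrow> 0"
  shows "cinner v Tu = cinner Tv u"
proof -
  have "(\<lambda>n. cnj (amp v n) * amp Tu n - cnj (amp Tv n) * amp u n) sums (cinner v Tu - cinner Tv u)"
    unfolding cinner_def by (intro sums_diff summable_sums summable_cinner)
  moreover have "(\<lambda>n. cnj (amp v n) * amp Tu n - cnj (amp Tv n) * amp u n) sums 0"
    unfolding sums_def Tu Tv jacobi_green_sum[of x, OF assms(1)] by (rule boundary)
  ultimately show ?thesis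
    using sums_unique2 by fastforce
qed

section \<open>Topology of the Fock space\<close>

lemma amp_sum: "amp (sum g A) n = (\<Sum>k\<in>A. amp (g k) n)"
  by (induction A rule: infinite_finite_induct) auto

lemma cinner_scaleC_ket: "cinner w (z *\<^sub>C ket n) = cnj (amp w n) * z"
proof -
  have "(\<lambda>k. cnj (amp w k) * amp (z *\<^sub>C ket n) k) sums
      (\<Sum>k\<in>{n}. cnj (amp w k) * amp (z *\<^sub>C ket n) k)"
    by (rule sums_finite) (auto simp: amp_scaleC amp_ket)
  then show ?thesis by (simp add: cinner_def sums_iff amp_scaleC amp_ket)
qed

text \<open>Real and imaginary part are the real inner products with \<open>v\<close> and with
  \<open>\<i> *\<^sub>C v\<close>, both continuous.\<close>

lemma continuous_on_cinner: "continuous_on UNIV (cinner v)"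
proof -
  have "cinner v t = Complex (inner v t) (inner (\<i> *\<^sub>C v) t)" for t
  proof -
    have "cinner (\<i> *\<^sub>C v) t = (\<Sum>n. - \<i> * (cnj (amp v n) * amp t n))"
      unfolding cinner_def by (simp add: amp_scaleC algebra_simps)
    also have "\<dots> = - \<i> * cinner v t"
      unfolding cinner_def by (rule suminf_mult[OF summable_cinner])
    finally show ?thesis
      by (simp add: inner_fock_def complex_eq_iff)
  qed
  then have "cinner v = (\<lambda>t. Complex (inner v t) (inner (\<i> *\<^sub>C v) t))"
    by blast
  then show ?thesis
    by (auto simp: continuous_on_def intro!: tendsto_intros)
qed

text \<open>For fixed \<open>v\<close> and \<open>w\<close> the adjoint relation describes a closed
  set of pairs, so it survives limits. Membership in the adjoint of a closure can thus be tested on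
  the original graph.\<close>

lemma adjoint_closure: "adjoint T \<subseteq> adjoint (closure T)"
proof
  fix p assume p: "p \<in> adjoint T"
  obtain v w where vw: "p = (v, w)" by (cases p)
  have "closed {s. cinner v (snd s) = cinner w (fst s)}"
    by (intro closed_Collect_eq continuous_on_compose2[OF continuous_on_cinner] continuous_intros)
       auto
  moreover have "T \<subseteq> {s. cinner v (snd s) = cinner w (fst s)}"
    using p vw by (auto simp: adjoint_def)
  ultimately have "closure T \<subseteq> {s. cinner v (snd s) = cinner w (fst s)}"
    by (rule closure_minimal[rotated])
  then show "p \<in> adjoint (closure T)"
    using vw by (auto simp: adjoint_def)
qed

definition truncate :: "fock \<Rightarrow> nat \<Rightarrow> fock" where
  "truncate f N = Fock (\<lambda>n. if n < N then amp f n else 0)"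

lemma amp_truncate: "amp (truncate f N) n = (if n < N then amp f n else 0)"
  unfolding truncate_def by (subst amp_Fock[OF summable_l2_finite[of "{..<N}"]]) auto

lemma truncate_finite_states: "truncate f N \<in> finite_states"
  unfolding finite_states_def
  by (auto simp: amp_truncate intro: finite_subset[of _ "{..<N}"])

text \<open>The squared error is the tail of the series for the squared norm.\<close>

lemma truncate_tendsto: "truncate f \<longlonglongrightarrow> f"
proof -
  have "(norm (truncate f N - f))\<^sup>2 = (norm f)\<^sup>2 - (\<Sum>n<N. (cmod (amp f n))\<^sup>2)" for N
  proof -
    have "(\<lambda>n. (cmod (amp f n))\<^sup>2 - (if n \<in> {..<N} then (cmod (amp f n))\<^sup>2 else 0)) sums
        ((norm f)\<^sup>2 - (\<Sum>n<N. (cmod (amp f n))\<^sup>2))"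
      by (intro sums_diff norm_fock_sums sums_If_finite_set) simp
    moreover have "(\<lambda>n. (cmod (amp f n))\<^sup>2 - (if n \<in> {..<N} then (cmod (amp f n))\<^sup>2 else 0)) =
        (\<lambda>n. (cmod (amp (truncate f N - f) n))\<^sup>2)"
      by (auto simp: amp_truncate)
    ultimately show ?thesis
      using norm_fock_sums[of "truncate f N - f"] sums_unique2 by simp
  qed
  moreover have "(\<lambda>N. (norm f)\<^sup>2 - (\<Sum>n<N. (cmod (amp f n))\<^sup>2)) \<longlonglongrightarrow> (norm f)\<^sup>2 - (norm f)\<^sup>2"
    by (intro tendsto_intros norm_fock_sums[unfolded sums_def])
  ultimately have "(\<lambda>N. (norm (truncate f N - f))\<^sup>2) \<longlonglongrightarrow> 0"
    by simp
  then have "(\<lambda>N. norm (truncate f N - f)) \<longlonglongrightarrow> 0"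
    using tendsto_real_sqrt by fastforce
  then show ?thesis
    using LIM_zero_cancel tendsto_norm_zero_iff by blast
qed

section \<open>Bounded Jacobi matrices\<close>

text \<open>Each row has at most two nonzero entries, so the squared output is dominated by two
  shifted copies of the squared input.\<close>

lemma
  assumes "\<And>n. \<bar>x n\<bar> \<le> B"
  shows summable_jacobi: "summable (\<lambda>n. (cmod (jacobi c x (amp f) n))\<^sup>2)"
    and suminf_jacobi_le: "(\<Sum>n. (cmod (jacobi c x (amp f) n))\<^sup>2) \<le> 6 * (cmod c * B)\<^sup>2 * (norm f)\<^sup>2"
proof -
  let ?K = "2 * (cmod c * B)\<^sup>2"
  let ?g = "\<lambda>n. ?K * ((cmod (amp f (Suc n)))\<^sup>2 + (cmod (amp f (n - 1)))\<^sup>2)"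
  let ?S = "?K * (((norm f)\<^sup>2 - (cmod (amp f 0))\<^sup>2) + ((norm f)\<^sup>2 + (cmod (amp f 0))\<^sup>2))"
  have B: "\<bar>x n\<bar>\<^sup>2 \<le> B\<^sup>2" for n
    using assms by (intro power_mono) auto
  have bound: "(cmod (jacobi c x (amp f) n))\<^sup>2 \<le> ?g n" for n
  proof -
    have "(cmod (jacobi c x (amp f) n))\<^sup>2 \<le>
        2 * ((cmod c)\<^sup>2 * \<bar>x (Suc n)\<bar>\<^sup>2 * (cmod (amp f (Suc n)))\<^sup>2
           + (cmod c)\<^sup>2 * \<bar>x n\<bar>\<^sup>2 * (cmod (amp f (n - 1)))\<^sup>2)"
      unfolding jacobi_def
      by (rule order_trans[OF cmod_add_square_le]) (simp add: norm_mult power_mult_distrib)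
    also have "\<dots> \<le> 2 * ((cmod c)\<^sup>2 * B\<^sup>2 * (cmod (amp f (Suc n)))\<^sup>2
           + (cmod c)\<^sup>2 * B\<^sup>2 * (cmod (amp f (n - 1)))\<^sup>2)"
      by (intro mult_left_mono add_mono mult_right_mono B) auto
    finally show ?thesis by (simp add: power_mult_distrib algebra_simps)
  qed
  have "(\<lambda>n. (cmod (amp f (Suc n)))\<^sup>2) sums ((norm f)\<^sup>2 - (cmod (amp f 0))\<^sup>2)"
    using norm_fock_sums[of f] by (subst sums_Suc_iff) simp
  \<comment> \<open>On naturals \<open>0 - 1 = 0\<close>, so this series counts
    \<open>amp f 0\<close> twice.\<close>
  moreover have "(\<lambda>n. (cmod (amp f (n - 1)))\<^sup>2) sums ((norm f)\<^sup>2 + (cmod (amp f 0))\<^sup>2)"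
    using norm_fock_sums[of f] sums_Suc[of "\<lambda>n. (cmod (amp f (n - 1)))\<^sup>2"] by simp
  ultimately have g: "?g sums ?S"
    by (intro sums_mult sums_add)
  show s: "summable (\<lambda>n. (cmod (jacobi c x (amp f) n))\<^sup>2)"
    by (rule summable_comparison_test'[where N = 0, OF sums_summable[OF g]]) (use bound in simp)
  have "(\<Sum>n. (cmod (jacobi c x (amp f) n))\<^sup>2) \<le> suminf ?g"
    by (intro suminf_le bound s sums_summable[OF g])
  also have "\<dots> = ?S"
    using g by (rule sums_unique[symmetric])
  \<comment> \<open>The terms with \<open>amp f 0\<close> cancel and leave the factor 4; the
    constant 6 is not sharp.\<close>
  also have "\<dots> \<le> 6 * (cmod c * B)\<^sup>2 * (norm f)\<^sup>2"
    by (simp add: algebra_simps)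
  finally show "(\<Sum>n. (cmod (jacobi c x (amp f) n))\<^sup>2) \<le> 6 * (cmod c * B)\<^sup>2 * (norm f)\<^sup>2" .
qed

lemma bounded_jacobi_op:
  assumes "x 0 = 0" and B: "\<And>n. \<bar>x n\<bar> \<le> B"
  shows "bounded_operator (closure (jacobi_op c x))" (is ?bounded)
    and "selfadjoint (closure (jacobi_op c x))" (is ?selfadjoint)
proof -
  define A where "A f = Fock (jacobi c x (amp f))" for f
  have amp_A: "amp (A f) = jacobi c x (amp f)" for f
    unfolding A_def by (intro amp_Fock summable_jacobi[of x, OF B])
  have A: "bounded_linear A"
  proof (rule bounded_linear_intro)
    show "A (f + g) = A f + A g" for f g
      by (rule fock_eqI) (simp add: amp_A jacobi_def algebra_simps)
    show "A (r *\<^sub>R f) = r *\<^sub>R A f" for r f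
      by (rule fock_eqI) (simp add: amp_A jacobi_def algebra_simps)
    show "norm (A f) \<le> norm f * sqrt (6 * (cmod c * B)\<^sup>2)" for f
    proof (rule power2_le_imp_le)
      have "(norm (A f))\<^sup>2 = (\<Sum>n. (cmod (jacobi c x (amp f) n))\<^sup>2)"
        using norm_fock_sums[of "A f"] by (simp add: sums_iff amp_A)
      also have "\<dots> \<le> 6 * (cmod c * B)\<^sup>2 * (norm f)\<^sup>2"
        by (rule suminf_jacobi_le[of x, OF B])
      finally show "(norm (A f))\<^sup>2 \<le> (norm f * sqrt (6 * (cmod c * B)\<^sup>2))\<^sup>2"
        by (simp add: power_mult_distrib mult.commute)
    qed simp
  qed
  have T0: "jacobi_op c x = {(f, A f) |f. f \<in> finite_states}"
    unfolding jacobi_op_def by (auto simp: fock_eq_iff amp_A)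
  \<comment> \<open>The graph of the continuous \<open>A\<close> is closed, and truncations approach
    each of its points.\<close>
  have T: "closure (jacobi_op c x) = {(f, A f) |f. True}"
  proof
    have "{(f, A f) |f. True} = {s. snd s = A (fst s)}" by auto
    moreover have "closed {s. snd s = A (fst s)}"
      by (intro closed_Collect_eq continuous_intros bounded_linear.continuous_on[OF A])
    ultimately show "closure (jacobi_op c x) \<subseteq> {(f, A f) |f. True}"
      by (intro closure_minimal) (auto simp: T0)
    show "{(f, A f) |f. True} \<subseteq> closure (jacobi_op c x)"
    proof clarify
      fix f
      have "(\<lambda>N. (truncate f N, A (truncate f N))) \<longlonglongrightarrow> (f, A f)"
        by (intro tendsto_Pair truncate_tendsto bounded_linear.tendsto[OF A])
      moreover have "(truncate f N, A (truncate f N)) \<in> jacobi_op c x" for N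
        using truncate_finite_states by (auto simp: T0)
      ultimately show "(f, A f) \<in> closure (jacobi_op c x)"
        unfolding closure_sequential by (intro exI[of _ "\<lambda>N. (truncate f N, A (truncate f N))"]) simp
    qed
  qed
  have "A (z *\<^sub>C f) = z *\<^sub>C A f" for z f
    by (rule fock_eqI) (simp add: amp_A amp_scaleC jacobi_def algebra_simps)
  then show ?bounded
    unfolding bounded_operator_def T using A by blast
  have sym: "cinner v (A u) = cinner (A v) u" for u v
  proof (rule jacobi_green[of x, OF assms(1) amp_A amp_A])
    have null: "(\<lambda>N. cmod (amp f N)) \<longlonglongrightarrow> 0" for f
      using tendsto_real_sqrt[OF summable_LIMSEQ_zero[OF summable_amp[of f]]] by simp
    \<comment> \<open>In each product the amplitude at index \<open>N\<close> tends to zero, while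
      the one at \<open>N - 1\<close> is bounded by a norm.\<close>
    have "cmod (of_real (x N) *
            (c * cnj (amp v (N - 1)) * amp u N - cnj c * cnj (amp v N) * amp u (N - 1)))
        \<le> B * (cmod c * norm v * cmod (amp u N) + cmod c * cmod (amp v N) * norm u)" for N
    proof -
      have "cmod (c * cnj (amp v (N - 1)) * amp u N - cnj c * cnj (amp v N) * amp u (N - 1))
          \<le> cmod c * cmod (amp v (N - 1)) * cmod (amp u N) + cmod c * cmod (amp v N) * cmod (amp u (N - 1))"
        by (rule order_trans[OF norm_triangle_ineq4]) (simp add: norm_mult)
      also have "\<dots> \<le> cmod c * norm v * cmod (amp u N) + cmod c * cmod (amp v N) * norm u"
        by (intro add_mono mult_mono cmod_amp_le_norm) auto
      finally show ?thesis
        unfolding norm_mult norm_of_real using B[of N] abs_ge_zero[of "x N"]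
        by (intro mult_mono) auto
    qed
    moreover have "(\<lambda>N. B * (cmod c * norm v * cmod (amp u N) + cmod c * cmod (amp v N) * norm u)) \<longlonglongrightarrow> 0"
    proof -
      have "(\<lambda>N. B * (cmod c * norm v * cmod (amp u N) + cmod c * cmod (amp v N) * norm u))
          \<longlonglongrightarrow> B * (cmod c * norm v * 0 + cmod c * 0 * norm u)"
        by (intro tendsto_add tendsto_mult tendsto_const null)
      then show ?thesis by simp
    qed
    ultimately show "(\<lambda>N. of_real (x N) * (c * cnj (amp v (N - 1)) * amp u N
        - cnj c * cnj (amp v N) * amp u (N - 1))) \<longlonglongrightarrow> 0"
      by (rule Lim_null_comparison[OF always_eventually, OF allI])
  qed
  have "w = A v" if "(v, w) \<in> adjoint {(f, A f) |f. True}" for v w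
  proof (rule fock_eqI)
    fix n
    \<comment> \<open>Testing on basis vectors already determines \<open>w\<close>; the scalar 1
      gives the shape that \<open>cinner_scaleC_ket\<close> expects.\<close>
    have "cinner v (A (1 *\<^sub>C ket n)) = cinner w (1 *\<^sub>C ket n)"
      using that by (auto simp: adjoint_def)
    then show "amp w n = amp (A v) n"
      by (simp add: sym cinner_scaleC_ket)
  qed
  then have "adjoint {(f, A f) |f. True} = {(f, A f) |f. True}"
    by (fastforce simp: adjoint_def intro: sym)
  then show ?selfadjoint
    unfolding selfadjoint_def T by (auto simp: Domain_unfold)
qed

section \<open>Geometrically growing Jacobi matrices\<close>

text \<open>Solutions of \<open>jacobi c x h (Suc n) = 0\<close> with prescribed initial values.\<close>

fun null_solution :: "complex \<Rightarrow> (nat \<Rightarrow> real) \<Rightarrow> complex \<Rightarrow> complex \<Rightarrow> nat \<Rightarrow> complex" where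
  "null_solution c x a b 0 = a"
| "null_solution c x a b (Suc 0) = b"
| "null_solution c x a b (Suc (Suc n)) =
     - (cnj c / c) * of_real (x (Suc n) / x (Suc (Suc n))) * null_solution c x a b n"

text \<open>Two steps of the recurrence shrink the squared modulus by the factor \<open>q\<close>,
  hence the rate \<open>sqrt q\<close> per index. Dividing by \<open>sqrt q\<close> in the constant
  accommodates the start value \<open>b\<close> at index 1.\<close>

lemma null_solution_decay:
  assumes "0 < q" "q < 1" and x: "\<And>n. (x (Suc n) / x (Suc (Suc n)))\<^sup>2 \<le> q"
  shows "(cmod (null_solution c x a b n))\<^sup>2 \<le> ((cmod a)\<^sup>2 + (cmod b)\<^sup>2 / sqrt q) * sqrt q ^ n"
proof (induction n rule: induct_nat_012)
  case 0
  then show ?case using assms by simp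
next
  case 1
  then show ?case using assms by (simp add: distrib_right)
next
  case (ge2 n)
  let ?h = "null_solution c x a b" and ?C = "(cmod a)\<^sup>2 + (cmod b)\<^sup>2 / sqrt q"
  \<comment> \<open>The modulus is 1, or 0 by the convention for division by zero when
    \<open>c = 0\<close>.\<close>
  have "cmod (cnj c / c) \<le> 1"
    by (simp add: norm_divide)
  then have "cmod (?h (Suc (Suc n))) \<le> 1 * \<bar>x (Suc n) / x (Suc (Suc n))\<bar> * cmod (?h n)"
    unfolding null_solution.simps norm_mult norm_of_real norm_minus_cancel
    by (intro mult_right_mono) auto
  then have "(cmod (?h (Suc (Suc n))))\<^sup>2 \<le> (\<bar>x (Suc n) / x (Suc (Suc n))\<bar> * cmod (?h n))\<^sup>2"
    by (intro power_mono) auto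
  also have "\<dots> = (x (Suc n) / x (Suc (Suc n)))\<^sup>2 * (cmod (?h n))\<^sup>2"
    by (simp only: power_mult_distrib power2_abs)
  also have "\<dots> \<le> q * (?C * sqrt q ^ n)"
    using assms ge2 by (intro mult_mono x) auto
  also have "\<dots> = ?C * sqrt q ^ Suc (Suc n)"
    using assms by simp
  finally show ?case .
qed

lemma not_selfadjoint_jacobi_op:
  assumes "c \<noteq> 0" "x 0 = 0" and nz: "\<And>n. x (Suc n) \<noteq> 0"
    and q: "0 < q" "q < 1" and x: "\<And>n. (x (Suc n) / x (Suc (Suc n)))\<^sup>2 \<le> q"
  shows "\<not> selfadjoint (closure (jacobi_op c x))"
proof
  assume "selfadjoint (closure (jacobi_op c x))"
  then have adj: "adjoint (closure (jacobi_op c x)) = closure (jacobi_op c x)"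
    by (simp add: selfadjoint_def)
  define h where "h a b = Fock (null_solution c x a b)" for a b
  have amp_h: "amp (h a b) = null_solution c x a b" for a b
    unfolding h_def
  proof (rule amp_Fock, rule summable_comparison_test'[where N = 0])
    show "summable (\<lambda>n. ((cmod a)\<^sup>2 + (cmod b)\<^sup>2 / sqrt q) * sqrt q ^ n)"
      using q by (intro summable_mult summable_geometric) simp
  qed (use null_solution_decay[of q x, OF q x] in simp)
  \<comment> \<open>The recurrence annihilates every row except row 0, where the entry
    \<open>c * x 1 * b\<close> survives.\<close>
  have in_adjoint: "(h a b, (c * of_real (x 1) * b) *\<^sub>C ket 0) \<in> adjoint (closure (jacobi_op c x))"
    for a b
  proof (rule subsetD[OF adjoint_closure], unfold adjoint_def, safe)
    fix u Tu assume "(u, Tu) \<in> jacobi_op c x"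
    then have fin: "finite {n. amp u n \<noteq> 0}" and Tu: "amp Tu = jacobi c x (amp u)"
      by (auto simp: jacobi_op_def finite_states_def)
    have "amp ((c * of_real (x 1) * b) *\<^sub>C ket 0) n = jacobi c x (amp (h a b)) n" for n
    proof (cases n)
      case 0
      then show ?thesis by (simp add: amp_h amp_scaleC amp_ket jacobi_def \<open>x 0 = 0\<close>)
    next
      case (Suc m)
      then show ?thesis
        using nz[of "Suc m"] \<open>c \<noteq> 0\<close> by (simp add: amp_h amp_scaleC amp_ket jacobi_def)
    qed
    then have Th: "amp ((c * of_real (x 1) * b) *\<^sub>C ket 0) = jacobi c x (amp (h a b))"
      by blast
    obtain M where M: "amp u n = 0" if "n \<ge> M" for n
      using fin unfolding finite_nat_set_iff_bounded by (metis (mono_tags) mem_Collect_eq not_less)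
    have "\<forall>\<^sub>F N in sequentially. of_real (x N) * (c * cnj (amp (h a b) (N - 1)) * amp u N
        - cnj c * cnj (amp (h a b) N) * amp u (N - 1)) = 0"
      \<comment> \<open>The boundary term involves \<open>u\<close> at \<open>N\<close> and at
        \<open>N - 1\<close>, hence the threshold \<open>Suc M\<close>.\<close>
      unfolding eventually_sequentially using M by (intro exI[of _ "Suc M"]) auto
    then show "cinner (h a b) Tu = cinner ((c * of_real (x 1) * b) *\<^sub>C ket 0) u"
      by (intro jacobi_green[of x, OF \<open>x 0 = 0\<close> Tu Th] tendsto_eventually)
  qed
  have "(h 0 1, (c * of_real (x 1)) *\<^sub>C ket 0) \<in> closure (jacobi_op c x)"
    using in_adjoint[of 0 1] adj by simp
  \<comment> \<open>Self-adjointness lets \<open>h 0 1\<close> be used as a test vector for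
    \<open>h 1 0\<close>, which the adjoint sends to zero. The other side is the Wronskian
    \<open>c * x 1\<close>.\<close>
  then have "cinner (h 1 0) ((c * of_real (x 1)) *\<^sub>C ket 0) = cinner (0 *\<^sub>C ket 0) (h 0 1)"
    using in_adjoint[of 1 0] by (auto simp: adjoint_def)
  moreover have "cinner (0 *\<^sub>C ket 0) (h 0 1) = 0"
    by (simp add: cinner_def amp_scaleC)
  moreover have "cinner (h 1 0) ((c * of_real (x 1)) *\<^sub>C ket 0) = c * of_real (x 1)"
    by (simp add: cinner_scaleC_ket amp_h)
  ultimately show False
    using \<open>c \<noteq> 0\<close> nz[of 0] by simp
qed

section \<open>The deformed oscillator\<close>

lemma x_coef_0: "x_coef q l lam 0 = 0"
  by (simp add: x_coef_def qnum_def)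

lemma amp_annih:
  assumes "f \<in> finite_states"
  shows "amp (annih q l lam f) n = of_real (x_coef q l lam (Suc n)) * amp f (Suc n)"
proof -
  have fin: "finite {k. amp f k \<noteq> 0}" using assms by (simp add: finite_states_def)
  have "amp (annih q l lam f) n =
      (\<Sum>k | amp f k \<noteq> 0. if k = Suc n then of_real (x_coef q l lam k) * amp f k else 0)"
    unfolding annih_def linear_extension_def amp_sum
    by (intro sum.cong) (auto simp: amp_scaleC amp_ket)
  then show ?thesis
    by (auto simp: sum.delta[OF fin])
qed

lemma amp_creat:
  assumes "f \<in> finite_states"
  shows "amp (creat q l lam f) n = of_real (x_coef q l lam n) * amp f (n - 1)"
proof -
  have fin: "finite {k. amp f k \<noteq> 0}" using assms by (simp add: finite_states_def)
  \<comment> \<open>For \<open>n = 0\<close> the condition selects \<open>k = 0\<close>, but the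
    coefficient \<open>x_coef q l lam 0\<close> vanishes there.\<close>
  have "amp (creat q l lam f) n =
      (\<Sum>k | amp f k \<noteq> 0. if k = n - 1 then of_real (x_coef q l lam n) * amp f k else 0)"
    unfolding creat_def linear_extension_def amp_sum
    by (intro sum.cong refl, cases n) (auto simp: amp_scaleC amp_ket x_coef_0)
  then show ?thesis
    by (auto simp: sum.delta[OF fin])
qed

lemma position_op_eq: "position_op q l lam = closure (jacobi_op 1 (x_coef q l lam))"
proof -
  have "amp (annih q l lam f + creat q l lam f) = jacobi 1 (x_coef q l lam) (amp f)"
    if "f \<in> finite_states" for f
    using that by (auto simp: jacobi_def amp_annih amp_creat)
  then show ?thesis
    unfolding position_op_def jacobi_op_def
    by (intro arg_cong[of _ _ closure]) (auto simp flip: amp_inject)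
qed

text \<open>The minus sign before \<open>creat\<close> is absorbed by
  \<open>cnj \<i> = - \<i>\<close>.\<close>

lemma momentum_op_eq: "momentum_op q l lam = closure (jacobi_op \<i> (x_coef q l lam))"
proof -
  have "amp (\<i> *\<^sub>C (annih q l lam f - creat q l lam f)) = jacobi \<i> (x_coef q l lam) (amp f)"
    if "f \<in> finite_states" for f
    using that by (auto simp: jacobi_def amp_scaleC amp_annih amp_creat algebra_simps)
  then show ?thesis
    unfolding momentum_op_def jacobi_op_def
    by (intro arg_cong[of _ _ closure]) (auto simp flip: amp_inject)
qed

lemma qnum_nonneg:
  assumes "q > 0"
  shows "qnum q n \<ge> 0"
  using assms one_le_power[of q n] power_le_one[of q n]
  by (cases "q \<ge> 1") (auto simp: qnum_def intro: divide_nonpos_nonpos divide_nonneg_nonneg)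

text \<open>Isolates the dependence on \<open>n\<close> in \<open>qnum q n / q ^ n\<close>, the
  quantity estimated for either range of \<open>q\<close>.\<close>

lemma x_coef_square:
  assumes "q > 0"
  shows "(x_coef q l lam n)\<^sup>2 = l\<^sup>2 * q powr lam * (qnum q n / q ^ n)"
  using assms qnum_nonneg[OF assms, of n]
  by (simp add: x_coef_def powr_diff powr_realpow)

text \<open>For \<open>q > 1\<close> the factor \<open>qnum q n / q ^ n\<close> stays below its
  limit \<open>1 / (q - 1)\<close>.\<close>

lemma x_coef_bounded:
  assumes "q > 1"
  shows "\<bar>x_coef q l lam n\<bar> \<le> sqrt (l\<^sup>2 * q powr lam * (1 / (q - 1)))"
proof -
  have "qnum q n / q ^ n \<le> 1 / (q - 1)"
  proof -
    have "qnum q n / q ^ n = (1 - 1 / q ^ n) * (1 / (q - 1))"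
      using assms by (simp add: qnum_def field_simps)
    also have "\<dots> \<le> 1 * (1 / (q - 1))"
      using assms by (intro mult_right_mono) auto
    finally show ?thesis by simp
  qed
  then have "(x_coef q l lam n)\<^sup>2 \<le> l\<^sup>2 * q powr lam * (1 / (q - 1))"
    using assms by (subst x_coef_square) (auto intro!: mult_left_mono simp del: times_divide_eq_right)
  then show ?thesis
    using real_le_rsqrt by (simp add: real_sqrt_le_iff flip: real_sqrt_abs)
qed

lemma x_coef_nonzero:
  assumes "0 < q" "q < 1" "l \<noteq> 0"
  shows "x_coef q l lam (Suc n) \<noteq> 0"
proof -
  have "q ^ Suc n < 1"
    using assms by (intro power_Suc_less_one) auto
  then have "qnum q (Suc n) > 0"
    using assms by (simp add: qnum_def)
  then show ?thesis
    using assms by (simp add: x_coef_def)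
qed

text \<open>The squared ratio is \<open>q\<close> times a quotient of consecutive
  \<open>qnum\<close> values, which is at most 1 by monotonicity.\<close>

lemma x_coef_ratio:
  assumes "0 < q" "q < 1" "l \<noteq> 0"
  shows "(x_coef q l lam (Suc n) / x_coef q l lam (Suc (Suc n)))\<^sup>2 \<le> q"
proof -
  have "qnum q (Suc n) \<le> qnum q (Suc (Suc n))"
    using assms by (auto simp: qnum_def intro!: divide_right_mono mult_left_le_one_le)
  then have "qnum q (Suc n) / q ^ Suc n \<le> q * (qnum q (Suc (Suc n)) / q ^ Suc (Suc n))"
    using assms by (simp add: divide_simps)
  then have "l\<^sup>2 * q powr lam * (qnum q (Suc n) / q ^ Suc n)
      \<le> l\<^sup>2 * q powr lam * (q * (qnum q (Suc (Suc n)) / q ^ Suc (Suc n)))"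
    by (intro mult_left_mono) auto
  then have "(x_coef q l lam (Suc n))\<^sup>2 \<le> q * (x_coef q l lam (Suc (Suc n)))\<^sup>2"
    using assms by (simp add: x_coef_square mult.left_commute del: power_Suc)
  then show ?thesis
    using x_coef_nonzero[OF assms, of lam "Suc n"] by (simp add: power_divide divide_le_eq)
qed

theorem theorem2p3:
  fixes q l lam :: real
  assumes "q > 0" and "q \<noteq> 1" and "l \<noteq> 0"
  shows "(q > 1 \<longrightarrow>
            bounded_operator (position_op q l lam) \<and> selfadjoint (position_op q l lam) \<and>
            bounded_operator (momentum_op q l lam) \<and> selfadjoint (momentum_op q l lam)) \<and>
         (q < 1 \<longrightarrow>
            \<not> selfadjoint (position_op q l lam) \<and> \<not> selfadjoint (momentum_op q l lam))"
proof -
  have "bounded_operator (closure (jacobi_op c (x_coef q l lam)))"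
    and "selfadjoint (closure (jacobi_op c (x_coef q l lam)))" if "q > 1" for c
    by (rule bounded_jacobi_op[of "x_coef q l lam", OF x_coef_0 x_coef_bounded[OF that]])+
  moreover have "\<not> selfadjoint (closure (jacobi_op c (x_coef q l lam)))" if "q < 1" "c \<noteq> 0" for c
    by (rule not_selfadjoint_jacobi_op[of c "x_coef q l lam" q])
       (use assms that x_coef_0 x_coef_nonzero x_coef_ratio in auto)
  ultimately show ?thesis
    unfolding position_op_eq momentum_op_eq by simp
qed

end
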